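(* Let $(G,\theta_1,\otimes_1,\iota_1,G_0)$ and $(H,\theta_2,\otimes_2,\iota_2,H_0)$ be almost groupoids, and let $\odot: G\times H\to H$, $(g,h)\mapsto g\odot h$, be an almost groupoid action of $G$ on $H$. Then the semidirect product of $G$ with $H$ via $\odot$ is also an almost groupoid. That is, $(G\times H,\theta,\cdot,\iota,G_0\times H_0)$ is an almost groupoid over $G_0\times H_0$, where: - the partial multiplication is $(g_1,h_1)\cdot(g_2,h_2):=(g_1\otimes_1 g_2,\; h_1\otimes_2(g_1\odot h_2))$, for all $(g_1,g_2)\in G_{(2)}$ and $(h_1,g_1\odot h_2)\in H_{(2)}$; - the units map $\theta:G\times H\to G_0\times H_0$ is $\theta(g,h):=(\theta_1(g),\theta_2(h))$ for all $g\in G$, $h\in H$; - the inversion $\iota:G\times H\to G\times H$ is $\iota(g,h):=(\iota_1(g),\; \iota_1(g)\odot\iota_2(h))$ for all $g\in G$, $h\in H$.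
   Context: **Almost groupoid.** An almost groupoid $(G,\theta,m,\iota,G_0)$ over $G_0$ is a pair $(G,G_0)$ of nonempty sets with $G_0\subseteq G$, endowed with a surjective map $\theta:G\to G_0$ (units map), a partial binary operation $m:G_{(2)}\to G$, $(x,y)\mapsto m(x,y):=x\cdot y$ (multiplication), whose domain is the set of composable pairs $$G_{(2)}:=\{(x,y)\in G\times G \mid \theta(x)=\theta(y)\},$$ and a map $\iota:G\to G$, $x\mapsto \iota(x):=x^{-1}$ (inversion), such that: (AG1) (associativity) $(x\cdot y)\cdot z=x\cdot(y\cdot z)$, in the sense that if one of the two products $(x\cdot y)\cdot z$ and $x\cdot(y\cdot z)$ is defined, then the other is also defined and they are equal; (AG2) (units) for each $x\in G$, $(\theta(x),x)\in G_{(2)}$ and $(x,\theta(x))\in G_{(2)}$, and $\theta(x)\cdot x=x\cdot\theta(x)=x$; (AG3) (inverses) for each $x\in G$, $(x,x^{-1})\in G_{(2)}$ and $(x^{-1},x)\in G_{(2)}$, and $x\cdot x^{-1}=x^{-1}\cdot x=\theta(x)$. For the almost groupoids $G$ and $H$ in the claim, the multiplications are written $\otimes_1$ and $\otimes_2$, so $G_{(2)}=\{(g,g')\in G\times G\mid\theta_1(g)=\theta_1(g')\}$ and $H_{(2)}=\{(h,h')\in H\times H\mid\theta_2(h)=\theta_2(h')\}$. **Convention.** Whenever a product is written in a given almost groupoid, it is assumed to be defined. **Almost groupoid action.** An almost groupoid action of $(G,\theta_1,\otimes_1,\iota_1,G_0)$ on $(H,\theta_2,\otimes_2,\iota_2,H_0)$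 is a map $\odot:G\times H\to H$, $(g,h)\mapsto g\odot h$, such that: (1) $(g_1\otimes_1 g_2)\odot h=g_1\odot(g_2\odot h)$ for all $(g_1,g_2)\in G_{(2)}$ and $h\in H$; (2) $g\odot(h_1\otimes_2 h_2)=(g\odot h_1)\otimes_2(g\odot h_2)$ for all $g\in G$ and $(h_1,h_2)\in H_{(2)}$; (3) for all $h\in H$ there exists an element $\theta_1(g)$ (with $g\in G$) such that $\theta_1(g)\odot h=h$; (4) $g\odot\theta_2(h)=\theta_2(h)$ for all $g\in G$ and $h\in H$.
   Formalization: Action axiom (3), "for all h there exists an element θ1(g) such that θ1(g)⊙h = h", is replaced by: θ1(g)⊙h = h for all g in G and h in H; with the original (3) the claim is false, as (AG2) for the semidirect product is equivalent to this condition. *)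

theory Defs
  imports Main
begin

definition composable :: "'a set \<Rightarrow> ('a \<Rightarrow> 'a) \<Rightarrow> ('a \<times> 'a) set"
  where "composable G \<theta> = {(x, y) \<in> G \<times> G. \<theta> x = \<theta> y}"

text \<open>
  The multiplication is a genuinely partial map, so that \<^term>\<open>dom m\<close> is its domain of definition.
  Equality of the two sides of \<open>AG1\<close> in the option type is Kleene equality:
  if one side is defined, then so is the other, and they agree.
\<close>

locale almost_groupoid =
  fixes G :: "'a set"
    and \<theta> :: "'a \<Rightarrow> 'a"
    and m :: "'a \<times> 'a \<rightharpoonup> 'a"
    and \<iota> :: "'a \<Rightarrow> 'a"
    and G0 :: "'a set"
  assumes nonempty: "G \<noteq> {}" "G0 \<noteq> {}"
    and base_subset: "G0 \<subseteq> G"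
    and units_surj: "\<theta> ` G = G0"
    and mult_dom: "dom m = composable G \<theta>"
    and mult_ran: "ran m \<subseteq> G"
    and inv_closed: "\<iota> ` G \<subseteq> G"
    and AG1: "\<And>x y z. x \<in> G \<Longrightarrow> y \<in> G \<Longrightarrow> z \<in> G \<Longrightarrow>
      Option.bind (m (x, y)) (\<lambda>u. m (u, z)) = Option.bind (m (y, z)) (\<lambda>v. m (x, v))"
    and AG2: "\<And>x. x \<in> G \<Longrightarrow> m (\<theta> x, x) = Some x \<and> m (x, \<theta> x) = Some x"
    and AG3: "\<And>x. x \<in> G \<Longrightarrow> m (x, \<iota> x) = Some (\<theta> x) \<and> m (\<iota> x, x) = Some (\<theta> x)"

text \<open>
  Axiom \<open>act_mult\<close> includes the definedness of the product on the right-hand side, following the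
  convention that every product that is written is assumed to be defined.

  Axiom \<open>act_unit\<close> renders ``for all \<open>h\<close> there exists an element \<open>\<theta>1 g\<close> (with \<open>g \<in> G\<close>) such that
  \<open>\<theta>1 g \<odot> h = h\<close>'' as: every unit \<open>\<theta>1 g\<close> fixes every \<open>h\<close>.  The literal reading, in which the unit
  is existentially quantified, does not suffice for the semidirect product: since
  \<open>(\<theta>1 g, \<theta>2 h) \<cdot> (g, h) = (g, \<theta>1 g \<odot> h)\<close>, the unit law of the semidirect product is equivalent to
  \<open>act_unit\<close>.  Counterexample: \<open>G = G0 = {u, v}\<close>, \<open>H\<close> a nontrivial group with identity \<open>e\<close>,
  \<open>u \<odot> h = h\<close>, \<open>v \<odot> h = e\<close>.
\<close>

locale almost_groupoid_action =
  G: almost_groupoid G \<theta>1 m1 \<iota>1 G0 + H: almost_groupoid H \<theta>2 m2 \<iota>2 H0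
  for G :: "'a set" and \<theta>1 m1 \<iota>1 G0
    and H :: "'b set" and \<theta>2 m2 \<iota>2 H0 +
  fixes act :: "'a \<Rightarrow> 'b \<Rightarrow> 'b"
  assumes act_closed: "\<And>g h. g \<in> G \<Longrightarrow> h \<in> H \<Longrightarrow> act g h \<in> H"
    and mult_act: "\<And>g1 g2 h. (g1, g2) \<in> composable G \<theta>1 \<Longrightarrow> h \<in> H \<Longrightarrow>
      act (the (m1 (g1, g2))) h = act g1 (act g2 h)"
    and act_mult: "\<And>g h1 h2. g \<in> G \<Longrightarrow> (h1, h2) \<in> composable H \<theta>2 \<Longrightarrow>
      m2 (act g h1, act g h2) = Some (act g (the (m2 (h1, h2))))"
    and act_unit: "\<And>g h. g \<in> G \<Longrightarrow> h \<in> H \<Longrightarrow> act (\<theta>1 g) h = h"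
    and act_base: "\<And>g h. g \<in> G \<Longrightarrow> h \<in> H \<Longrightarrow> act g (\<theta>2 h) = \<theta>2 h"

definition sdp_units :: "('a \<Rightarrow> 'a) \<Rightarrow> ('b \<Rightarrow> 'b) \<Rightarrow> 'a \<times> 'b \<Rightarrow> 'a \<times> 'b"
  where "sdp_units \<theta>1 \<theta>2 = (\<lambda>(g, h). (\<theta>1 g, \<theta>2 h))"

text \<open>
  The guard \<open>h2 \<in> H\<close> is needed because \<open>act\<close> is a total function at the type level:
  \<open>act g1 h2\<close> may lie in \<open>H\<close> even when \<open>h2\<close> does not.  The domain is the one in terms of
  \<open>(h1, g1 \<odot> h2)\<close>, not the one in terms of \<^const>\<open>sdp_units\<close>; their agreement is part of being an
  almost groupoid.
\<close>

definition sdp_mult ::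
  "'a set \<Rightarrow> ('a \<Rightarrow> 'a) \<Rightarrow> ('a \<times> 'a \<rightharpoonup> 'a) \<Rightarrow> 'b set \<Rightarrow> ('b \<Rightarrow> 'b) \<Rightarrow> ('b \<times> 'b \<rightharpoonup> 'b) \<Rightarrow>
    ('a \<Rightarrow> 'b \<Rightarrow> 'b) \<Rightarrow> ('a \<times> 'b) \<times> ('a \<times> 'b) \<rightharpoonup> 'a \<times> 'b"
  where "sdp_mult G \<theta>1 m1 H \<theta>2 m2 act = (\<lambda>((g1, h1), (g2, h2)).
    if (g1, g2) \<in> composable G \<theta>1 \<and> h2 \<in> H \<and> (h1, act g1 h2) \<in> composable H \<theta>2
    then Some (the (m1 (g1, g2)), the (m2 (h1, act g1 h2)))
    else None)"

definition sdp_inv ::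
  "('a \<Rightarrow> 'a) \<Rightarrow> ('b \<Rightarrow> 'b) \<Rightarrow> ('a \<Rightarrow> 'b \<Rightarrow> 'b) \<Rightarrow> 'a \<times> 'b \<Rightarrow> 'a \<times> 'b"
  where "sdp_inv \<iota>1 \<iota>2 act = (\<lambda>(g, h). (\<iota>1 g, act (\<iota>1 g) (\<iota>2 h)))"

end

theory Submission
  imports Defs
begin

text \<open>
  The action preserves \<open>\<theta>2\<close>: \<open>(h, \<theta>2 h)\<close> is composable, so \<open>g \<odot> h\<close> and \<open>g \<odot> \<theta>2 h = \<theta>2 h\<close> are
  composable too, that is, \<open>\<theta>2 (g \<odot> h) = \<theta>2 h\<close>.  Hence a product in the semidirect product is
  defined if and only if both pairs of components are composable, and the axioms can be
  verified as for the semidirect product of groups.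
\<close>

context almost_groupoid
begin

lemma mult_eq_Some_the:
  assumes "x \<in> G" "y \<in> G" "\<theta> x = \<theta> y"
  shows "m (x, y) = Some (the (m (x, y)))"
proof -
  have "(x, y) \<in> dom m"
    using assms by (simp add: mult_dom composable_def)
  then show ?thesis by auto
qed

text \<open>Definedness is the source of the unit identities: whenever an axiom asserts that a
  product exists, the third conclusion equates the units of its factors.\<close>

lemma mult_SomeD:
  assumes "m (x, y) = Some z"
  shows "x \<in> G" "y \<in> G" "\<theta> x = \<theta> y" "z \<in> G"
proof -
  have "(x, y) \<in> composable G \<theta>"
    using assms mult_dom by blast
  then show "x \<in> G" "y \<in> G" "\<theta> x = \<theta> y"
    by (auto simp: composable_def)
  show "z \<in> G"
    using assms mult_ran by (auto intro: ranI)
qed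

lemma units_closed: "x \<in> G \<Longrightarrow> \<theta> x \<in> G"
  using units_surj base_subset by blast

lemma units_idem: "x \<in> G \<Longrightarrow> \<theta> (\<theta> x) = \<theta> x"
  using AG2 mult_SomeD(3) by blast

lemma inverse_closed: "x \<in> G \<Longrightarrow> \<iota> x \<in> G"
  using inv_closed by blast

lemma units_inverse: "x \<in> G \<Longrightarrow> \<theta> (\<iota> x) = \<theta> x"
  using AG3 mult_SomeD(3) by blast

lemma mult_closed: "x \<in> G \<Longrightarrow> y \<in> G \<Longrightarrow> \<theta> x = \<theta> y \<Longrightarrow> the (m (x, y)) \<in> G"
  using mult_eq_Some_the mult_SomeD(4) by blast

text \<open>Reassociating the product of \<open>\<theta> x\<close>, \<open>x\<close> and
  \<open>y\<close> shows that \<open>\<theta> x\<close> times the product of \<open>x\<close> and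
  \<open>y\<close> is defined, so these two factors have the same unit.\<close>

lemma units_mult:
  assumes "x \<in> G" "y \<in> G" "\<theta> x = \<theta> y"
  shows "\<theta> (the (m (x, y))) = \<theta> x"
proof -
  obtain z where z: "m (x, y) = Some z"
    using assms mult_eq_Some_the by blast
  have "Option.bind (m (\<theta> x, x)) (\<lambda>u. m (u, y)) = Option.bind (m (x, y)) (\<lambda>v. m (\<theta> x, v))"
    using assms by (intro AG1 units_closed)
  then have "m (\<theta> x, z) = Some z"
    using AG2[OF assms(1)] z by simp
  from mult_SomeD(3)[OF this] show ?thesis
    using assms z by (simp add: units_idem)
qed

lemma mult_assoc:
  assumes "x \<in> G" "y \<in> G" "z \<in> G" "\<theta> x = \<theta> y" "\<theta> y = \<theta> z"
  shows "the (m (the (m (x, y)), z)) = the (m (x, the (m (y, z))))"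
proof -
  obtain u v where "m (x, y) = Some u" "m (y, z) = Some v"
    using assms mult_eq_Some_the by meson
  then show ?thesis
    using AG1[of x y z] assms by simp
qed

end

context almost_groupoid_action
begin

lemma units_act:
  assumes "g \<in> G" "h \<in> H"
  shows "\<theta>2 (act g h) = \<theta>2 h"
proof -
  have "(h, \<theta>2 h) \<in> composable H \<theta>2"
    using assms by (simp add: composable_def H.units_closed H.units_idem)
  from H.mult_SomeD(3)[OF act_mult[OF assms(1) this]] show ?thesis
    using assms by (simp add: act_base H.units_idem)
qed

lemma act_mult_the:
  assumes "g \<in> G" "h1 \<in> H" "h2 \<in> H" "\<theta>2 h1 = \<theta>2 h2"
  shows "act g (the (m2 (h1, h2))) = the (m2 (act g h1, act g h2))"
  using act_mult[of g h1 h2] assms by (simp add: composable_def)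

lemma mult_act':
  assumes "g1 \<in> G" "g2 \<in> G" "\<theta>1 g1 = \<theta>1 g2" "h \<in> H"
  shows "act (the (m1 (g1, g2))) h = act g1 (act g2 h)"
  using mult_act assms by (simp add: composable_def)

text \<open>The product of \<open>g\<close> and \<open>\<iota>1 g\<close> is a unit, which acts
  trivially. This cancels the twist in the right inverse law.\<close>

lemma act_act_inverse:
  assumes "g \<in> G" "h \<in> H"
  shows "act g (act (\<iota>1 g) h) = h"
  using mult_act'[of g "\<iota>1 g" h] assms
  by (simp add: G.AG3 G.inverse_closed G.units_inverse act_unit)

abbreviation sdp :: "('a \<times> 'b) \<times> ('a \<times> 'b) \<rightharpoonup> 'a \<times> 'b"
  where "sdp \<equiv> sdp_mult G \<theta>1 m1 H \<theta>2 m2 act"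

text \<open>By \<open>units_act\<close>, the condition on \<open>act g1 h2\<close> becomes one on
  \<open>h2\<close>, so the domain no longer involves the action and matches composability under
  \<open>sdp_units\<close>.\<close>

lemma sdp_mult_eq:
  "sdp ((g1, h1), (g2, h2)) =
    (if g1 \<in> G \<and> g2 \<in> G \<and> h1 \<in> H \<and> h2 \<in> H \<and> \<theta>1 g1 = \<theta>1 g2 \<and> \<theta>2 h1 = \<theta>2 h2
     then Some (the (m1 (g1, g2)), the (m2 (h1, act g1 h2))) else None)"
  by (auto simp: sdp_mult_def composable_def units_act act_closed)

lemma sdp_assoc:
  assumes g: "g1 \<in> G" "g2 \<in> G" "g3 \<in> G" and h: "h1 \<in> H" "h2 \<in> H" "h3 \<in> H"
  shows "Option.bind (sdp ((g1, h1), (g2, h2))) (\<lambda>u. sdp (u, (g3, h3))) =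
    Option.bind (sdp ((g2, h2), (g3, h3))) (\<lambda>v. sdp ((g1, h1), v))"
\<comment> \<open>A product has the unit of its factors, so either bracketing is defined exactly
  when these four equations hold.\<close>
proof (cases "\<theta>1 g1 = \<theta>1 g2 \<and> \<theta>1 g2 = \<theta>1 g3 \<and> \<theta>2 h1 = \<theta>2 h2 \<and> \<theta>2 h2 = \<theta>2 h3")
  case True
  \<comment> \<open>These are the second components, with the action of the product of
    \<open>g1\<close> and \<open>g2\<close> on \<open>h3\<close> already split in two. Distributing
    \<open>act g1\<close> on the right reduces the claim to associativity in
    \<open>H\<close>.\<close>
  have "the (m2 (the (m2 (h1, act g1 h2)), act g1 (act g2 h3))) =
      the (m2 (h1, act g1 (the (m2 (h2, act g2 h3)))))"
    using True g h by (simp add: H.mult_assoc act_mult_the act_closed units_act)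
  then show ?thesis
    using True g h
    by (simp add: sdp_mult_eq G.mult_closed H.mult_closed G.units_mult H.units_mult
        G.mult_assoc mult_act' act_closed units_act)
next
  case False
  then show ?thesis
    using g h
    by (auto simp: sdp_mult_eq G.units_mult H.units_mult act_closed units_act)
qed

lemma almost_groupoid_sdp:
  "almost_groupoid (G \<times> H) (sdp_units \<theta>1 \<theta>2) sdp (sdp_inv \<iota>1 \<iota>2 act) (G0 \<times> H0)"
proof
  show "G \<times> H \<noteq> {}" "G0 \<times> H0 \<noteq> {}"
    using G.nonempty H.nonempty by auto
  show "G0 \<times> H0 \<subseteq> G \<times> H"
    using G.base_subset H.base_subset by auto
  show "sdp_units \<theta>1 \<theta>2 ` (G \<times> H) = G0 \<times> H0"
    unfolding G.units_surj[symmetric] H.units_surj[symmetric]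
    by (force simp: sdp_units_def)
  show "dom sdp = composable (G \<times> H) (sdp_units \<theta>1 \<theta>2)"
    by (auto simp: dom_def sdp_mult_eq composable_def sdp_units_def split: if_splits)
  show "ran sdp \<subseteq> G \<times> H"
    by (auto simp: ran_def sdp_mult_eq G.mult_closed H.mult_closed act_closed units_act
        split: if_splits)
  show "sdp_inv \<iota>1 \<iota>2 act ` (G \<times> H) \<subseteq> G \<times> H"
    by (auto simp: sdp_inv_def G.inverse_closed H.inverse_closed act_closed)
next
  fix x y z assume "x \<in> G \<times> H" "y \<in> G \<times> H" "z \<in> G \<times> H"
  then show "Option.bind (sdp (x, y)) (\<lambda>u. sdp (u, z)) =
      Option.bind (sdp (y, z)) (\<lambda>v. sdp (x, v))"
    by (auto simp: sdp_assoc)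
next
  fix x assume "x \<in> G \<times> H"
  then obtain g h where x: "x = (g, h)" "g \<in> G" "h \<in> H" by auto
  \<comment> \<open>The left unit law rests on \<open>act_unit\<close>, the right one on
    \<open>act_base\<close>.\<close>
  show "sdp (sdp_units \<theta>1 \<theta>2 x, x) = Some x \<and> sdp (x, sdp_units \<theta>1 \<theta>2 x) = Some x"
    using x by (simp add: sdp_units_def sdp_mult_eq G.units_closed H.units_closed
        G.units_idem H.units_idem G.AG2 H.AG2 act_unit act_base)
  \<comment> \<open>For the left inverse law, \<open>act (\<iota>1 g)\<close> is pulled out of the
    product; what remains is its value at \<open>\<theta>2 h\<close>, which it fixes.\<close>
  have "the (m2 (act (\<iota>1 g) (\<iota>2 h), act (\<iota>1 g) h)) = \<theta>2 h"
    using x act_mult_the[of "\<iota>1 g" "\<iota>2 h" h]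
    by (simp add: G.inverse_closed H.inverse_closed H.units_inverse H.AG3 act_base)
  then show "sdp (x, sdp_inv \<iota>1 \<iota>2 act x) = Some (sdp_units \<theta>1 \<theta>2 x) \<and>
      sdp (sdp_inv \<iota>1 \<iota>2 act x, x) = Some (sdp_units \<theta>1 \<theta>2 x)"
    using x by (simp add: sdp_units_def sdp_inv_def sdp_mult_eq G.inverse_closed
        H.inverse_closed G.units_inverse H.units_inverse act_closed units_act
        act_act_inverse G.AG3 H.AG3)
qed

end

theorem theorem4p1:
  fixes G G0 :: "'a set" and H H0 :: "'b set"
    and \<theta>1 \<iota>1 :: "'a \<Rightarrow> 'a" and \<theta>2 \<iota>2 :: "'b \<Rightarrow> 'b"
    and m1 :: "'a \<times> 'a \<rightharpoonup> 'a" and m2 :: "'b \<times> 'b \<rightharpoonup> 'b"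
    and act :: "'a \<Rightarrow> 'b \<Rightarrow> 'b"
  assumes "almost_groupoid G \<theta>1 m1 \<iota>1 G0"
    and "almost_groupoid H \<theta>2 m2 \<iota>2 H0"
    and "almost_groupoid_action G \<theta>1 m1 \<iota>1 G0 H \<theta>2 m2 \<iota>2 H0 act"
  shows "almost_groupoid (G \<times> H)
    (sdp_units \<theta>1 \<theta>2)
    (sdp_mult G \<theta>1 m1 H \<theta>2 m2 act)
    (sdp_inv \<iota>1 \<iota>2 act)
    (G0 \<times> H0)"
  using assms(3) by (rule almost_groupoid_action.almost_groupoid_sdp)

end
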